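(* Let $k\in\mathbb{Z}$, $n \geq 1$ and $1 \leq j \leq n$. Then \begin{equation*} \begin{split} &\sum_{m=j}^{n}\frac{\binom{m}{j}}{(m-j+1)^{k}}S_{1}(n,m)\\ &=\sum_{l=0}^{n-j}\sum_{l_{1}+\cdots + l_{n}=l}\binom{n-1}{l_{1},\cdots , l_{n},n-1-l}\binom{n-l}{j}\frac{ B_{l_{1}} \cdots B_{l_{n}}}{(n-l-j+1)^k}\\ &=(-1)^{n+j} n! \sum_{a=j}^{n}\sum_{l=j-1}^{a-1}\frac{(-1)^{l+1-j}}{a!}\binom{n-1}{a-1}\binom{a-1}{l}\binom{l+1}{j}\frac{B_{a-1-l}^{(a)}}{(l+2-j)^{k}}. \end{split} \end{equation*} Moreover, for $k\in\mathbb{Z}$ and $n\ge 1$, \begin{equation*} \begin{split} C_{n}^{(k)}&=\sum_{m=0}^{n}\frac{S_{1}(n,m)}{(m+1)^{k}}=\sum_{l=0}^{n-1}\sum_{l_{1}+\cdots + l_{n}=l}\binom{n-1}{l_{1},\cdots , l_{n},n-1-l}\frac{ B_{l_{1}} \cdots B_{l_{n}}}{(n-l+1)^k}\\ &=(-1)^n n! \sum_{a=1}^{n}\sum_{l=0}^{a-1}\frac{(-1)^{l+1}}{a!}\binom{n-1}{a-1}\binom{a-1}{l}\frac{B_{a-1-l}^{(a)}}{(l+2)^{k}}. \end{split} \end{equation*} Here the sums over $l_1+\cdots+l_n=l$ run over $n$-tuples of nonnegative integers.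
   Context: For $k\in\mathbb{Z}$, $Lif_k(t)=\sum_{m=0}^{\infty}\frac{t^m}{m!(m+1)^k}$, and the poly-Cauchy polynomials $C_n^{(k)}(x)$ are defined by $\frac{Lif_k(\log(1+t))}{(1+t)^x}=\sum_{n=0}^\infty C_n^{(k)}(x)\frac{t^n}{n!}$; the poly-Cauchy numbers are $C_n^{(k)}=C_n^{(k)}(0)$. The (signed) Stirling numbers of the first kind $S_1(l,m)$ are defined by $(\log(1+t))^m=m!\sum_{l\ge m}S_1(l,m)\frac{t^l}{l!}$, equivalently $x(x-1)\cdots(x-n+1)=\sum_{l=0}^n S_1(n,l)x^l$. $B_l$ is the $l$-th Bernoulli number ($\frac{t}{e^t-1}=\sum B_l t^l/l!$), and the Bernoulli numbers of order $a$ are given by $\left(\frac{t}{e^t-1}\right)^a=\sum_{n\ge0}B_n^{(a)}\frac{t^n}{n!}$. The multinomial coefficient is $\binom{n-1}{l_1,\dots,l_n,n-1-l}=\frac{(n-1)!}{l_1!\cdots l_n!(n-1-l)!}$. *)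

theory Defs
  imports Complex_Main "HOL-Computational_Algebra.Formal_Power_Series"
begin

definition Lif :: "int \<Rightarrow> complex fps" where
  "Lif k = Abs_fps (\<lambda>m. 1 / (fact m * of_nat (m + 1) powi k))"

text \<open>
  As formal power series in \<open>t\<close>, \<open>fps_ln 1\<close> is \<open>log (1 + t)\<close> and \<open>fps_binomial x\<close>
  is \<open>(1 + t)\<close> to the power \<open>x\<close>.
\<close>

definition poly_cauchy :: "int \<Rightarrow> nat \<Rightarrow> complex \<Rightarrow> complex" where
  "poly_cauchy k n x = fact n * fps_nth ((Lif k oo fps_ln 1) / fps_binomial x) n"

definition poly_cauchy_number :: "int \<Rightarrow> nat \<Rightarrow> complex" where
  "poly_cauchy_number k n = poly_cauchy k n 0"

text \<open>
  Signed, unlike \<open>stirling\<close> of \<open>HOL-Combinatorics\<close>: read off from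
  \<open>log (1 + t) ^ m = m! (\<Sum>l\<ge>m. S1 l m t ^ l / l!)\<close>.
\<close>

definition S1 :: "nat \<Rightarrow> nat \<Rightarrow> complex" where
  "S1 l m = fact l * fps_nth (fps_ln 1 ^ m) l / fact m"

definition bernoulli_order :: "nat \<Rightarrow> nat \<Rightarrow> complex" where
  "bernoulli_order a n = fact n * fps_nth ((fps_X / (fps_exp 1 - 1)) ^ a) n"

definition bernoulli_number :: "nat \<Rightarrow> complex" where
  "bernoulli_number n = fact n * fps_nth (fps_X / (fps_exp 1 - 1)) n"

text \<open>
  \<open>multinomial N ls\<close> has as lower entries the list \<open>ls\<close> followed by the remainder
  \<open>N - sum_list ls\<close>; it is only meaningful for \<open>sum_list ls \<le> N\<close>.
\<close>

definition multinomial :: "nat \<Rightarrow> nat list \<Rightarrow> complex" where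
  "multinomial N ls = fact N / ((\<Prod>i\<leftarrow>ls. fact i) * fact (N - sum_list ls))"

end

theory Submission
  imports Defs
begin

text \<open>
  Everything reduces to two facts about the Stirling numbers. The first is the explicit formula
  \<open>S1 n m = (n - 1 choose m - 1) * B\<^bsub>n - m\<^esub>\<^bsup>(n)\<^esup>\<close>, which holds since both sides satisfy the same
  recurrence; on the Bernoulli side it comes from the differential equation
  \<open>t g' = g - t g - g\<^sup>2\<close> of \<open>g = t / (e\<^sup>t - 1)\<close>. The second is
  \<open>(-1)\<^sup>n\<^sup>+\<^sup>m S1 n m = (\<Sum>a. n! / a! * (n - 1 choose a - 1) * S1 a m)\<close>, which is the substitution
  \<open>log (1 + t / (1 - t)) = - log (1 - t)\<close>. Given these, both chains of equalities hold with arbitrary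
  weights \<open>w m\<close> in place of \<open>(m choose j) / (m - j + 1)\<^sup>k\<close> and \<open>1 / (m + 1)\<^sup>k\<close>.
\<close>

unbundle fps_syntax

section \<open>Recurrence for the signed Stirling numbers\<close>

lemma S1_0_right: "S1 (Suc n) 0 = 0"
  by (simp add: S1_def)

lemma S1_eq_0: "n < m \<Longrightarrow> S1 n m = 0"
  by (simp add: S1_def startsby_zero_power_prefix)

text \<open>With L = log (1 + t), the equation (1 + t) L' = 1 gives (1 + t) (L^(m+1))' = (m + 1)
  L^m. The recurrence is the coefficient of this at t^n, rescaled by n! / (m + 1)!.\<close>

lemma S1_Suc_Suc: "S1 (Suc n) (Suc m) = S1 n m - of_nat n * S1 n (Suc m)"
proof -
  define L :: "complex fps" where "L = fps_ln 1"
  have "(1 + fps_X) * fps_deriv L = 1"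
    by (simp add: L_def fps_ln_deriv inverse_mult_eq_1')
  then have "(1 + fps_X) * fps_deriv (L ^ Suc m) = of_nat (Suc m) * L ^ m"
    by (simp only: fps_deriv_power' diff_Suc_1 mult.assoc mult.left_commute[of "of_nat _"])
       (metis mult.assoc mult_1)
  then have "((1 + fps_X) * fps_deriv (L ^ Suc m)) $ n = (of_nat (Suc m) * L ^ m) $ n"
    by simp
  then have coeff: "of_nat (Suc n) * (L ^ Suc m $ Suc n) + of_nat n * (L ^ Suc m $ n)
      = of_nat (Suc m) * (L ^ m $ n)"
    by (cases n) (simp_all add: ring_distribs del: power_Suc of_nat_Suc)
  have "S1 (Suc n) (Suc m) + of_nat n * S1 n (Suc m)
      = fact n / fact (Suc m) *
        (of_nat (Suc n) * (L ^ Suc m $ Suc n) + of_nat n * (L ^ Suc m $ n))"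
    by (simp add: S1_def L_def add_divide_distrib algebra_simps del: power_Suc of_nat_Suc)
  also have "\<dots> = S1 n m"
    unfolding coeff by (simp add: S1_def L_def field_simps del: of_nat_Suc)
  finally show ?thesis
    by (simp add: algebra_simps)
qed

lemma S1_self: "S1 n n = 1"
  by (induction n) (simp_all add: S1_Suc_Suc S1_eq_0 S1_def[of 0 0])

section \<open>Bernoulli numbers of higher order\<close>

lemma fps_bernoulli_mult: "fps_X / (fps_exp 1 - 1) * (fps_exp 1 - 1 :: complex fps) = fps_X"
proof -
  \<comment> \<open>Both t and e^t - 1 have order 1, so the division of power series is
    exact.\<close>
  have "subdegree (fps_exp 1 - 1 :: complex fps) = 1"
    by (rule subdegreeI) (auto simp: less_Suc_eq)
  moreover have "(fps_exp 1 - 1 :: complex fps) \<noteq> 0"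
    by simp
  ultimately show ?thesis
    by (metis dvd_div_mult_self fps_dvd_iff fps_X_neq_zero order_refl subdegree_fps_X)
qed

lemma bernoulli_order_0_right: "bernoulli_order n 0 = 1"
proof -
  have "(fps_X / (fps_exp 1 - 1) * (fps_exp 1 - 1 :: complex fps)) $ 1 = 1"
    by (subst fps_bernoulli_mult) simp
  then show ?thesis
    by (simp add: bernoulli_order_def fps_mult_nth fps_power_zeroth)
qed

text \<open>For n > 0, multiplying the differential equation of g by n g^(n-1) gives n g^(n+1) = n
  (1 - t) g^n - t (g^n)', which links order n + 1 to order n. The claim is its coefficient at
  t^(i+1).\<close>

lemma bernoulli_order_Suc_Suc:
  "of_nat n * bernoulli_order (Suc n) (Suc i)
    = (of_nat n - of_nat (Suc i)) * bernoulli_order n (Suc i)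
      - of_nat n * of_nat (Suc i) * bernoulli_order n i"
proof -
  define g :: "complex fps" where "g = fps_X / (fps_exp 1 - 1)"
  define E :: "complex fps" where "E = fps_exp 1"
  have gE: "g * (E - 1) = fps_X"
    unfolding g_def E_def by (rule fps_bernoulli_mult)
  have "fps_deriv (g * (E - 1)) = 1"
    unfolding gE by simp
  then have "g * E + fps_deriv g * (E - 1) = 1"
    by (simp add: E_def)
  \<comment> \<open>The factor g eliminates the exponential: g E = g (E - 1) + g, and g (E - 1) is
    t.\<close>
  then have "g * (g * E + fps_deriv g * (E - 1)) = g"
    by simp
  then have "g * (g * (E - 1)) + g * g + fps_deriv g * (g * (E - 1)) = g"
    by (simp add: algebra_simps)
  then have ode: "g * fps_X + g * g + fps_deriv g * fps_X = g"
    unfolding gE .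
  have "of_nat n * g ^ Suc n = of_nat n * (1 - fps_X) * g ^ n - fps_X * fps_deriv (g ^ n)"
  proof (cases n)
    case (Suc p)
    have "of_nat n * (1 - fps_X) * g ^ n - fps_X * fps_deriv (g ^ n)
        = of_nat n * g ^ p * (g - fps_X * g - fps_X * fps_deriv g)"
      unfolding Suc fps_deriv_power' by (simp add: algebra_simps)
    also have "g - fps_X * g - fps_X * fps_deriv g = g * g"
      using ode by (simp add: algebra_simps)
    finally show ?thesis
      by (simp only: Suc power_Suc mult_ac)
  qed simp
  then have "(of_nat n * g ^ Suc n) $ Suc i
      = (of_nat n * ((1 - fps_X) * g ^ n) - fps_X * fps_deriv (g ^ n)) $ Suc i"
    by (simp add: mult.assoc)
  then have coeff: "of_nat n * (g ^ Suc n $ Suc i)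
      = (of_nat n - of_nat (Suc i)) * (g ^ n $ Suc i) - of_nat n * (g ^ n $ i)"
    by (simp add: algebra_simps del: power_Suc)
  have "of_nat n * bernoulli_order (Suc n) (Suc i) = fact (Suc i) * (of_nat n * (g ^ Suc n $ Suc i))"
    by (simp add: bernoulli_order_def g_def del: power_Suc)
  also have "\<dots> = (of_nat n - of_nat (Suc i)) * bernoulli_order n (Suc i)
      - of_nat n * of_nat (Suc i) * bernoulli_order n i"
    unfolding coeff by (simp add: bernoulli_order_def g_def algebra_simps)
  finally show ?thesis .
qed

section \<open>Explicit formula for the Stirling numbers\<close>

lemma S1_eq_bernoulli_order:
  "m \<le> n \<Longrightarrow> S1 (Suc n) (Suc m) = of_nat (n choose m) * bernoulli_order (Suc n) (n - m)"
proof (induction n arbitrary: m)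
  case 0
  then show ?case
    by (simp add: S1_self bernoulli_order_0_right)
next
  case (Suc n)
  note rec = bernoulli_order_Suc_Suc[of "Suc n"]
  show ?case
  proof (cases m)
    case 0
    \<comment> \<open>At this index the factor (n + 1) - (n + 1) kills the first term of
      \<open>rec\<close>, just as S1 (n + 1) 0 = 0 does on the Stirling side.\<close>
    have "of_nat (Suc n) * bernoulli_order (Suc (Suc n)) (Suc n)
        = of_nat (Suc n) * (- of_nat (Suc n) * bernoulli_order (Suc n) n)"
      using rec[of n] by (simp del: of_nat_Suc)
    then have "bernoulli_order (Suc (Suc n)) (Suc n) = - of_nat (Suc n) * bernoulli_order (Suc n) n"
      unfolding mult_cancel_left using of_nat_neq_0 by blast
    then show ?thesis
      using Suc.IH[of 0] by (simp add: 0 S1_Suc_Suc[of "Suc n"] S1_0_right del: of_nat_Suc)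
  next
    case (Suc p)
    show ?thesis
    proof (cases "p = n")
      case True
      then show ?thesis
        by (simp add: Suc S1_self bernoulli_order_0_right)
    next
      case False
      \<comment> \<open>The two Stirling predecessors, with lower entries p + 1 and p + 2, carry the
        Bernoulli indices i + 1 and i.\<close>
      define i where "i = n - Suc p"
      have n: "n = Suc p + i"
        using False Suc Suc.prems by (simp add: i_def)
      \<comment> \<open>\<open>rec\<close> gives the new Bernoulli number only with the factor n +
        1, so the identity is proved multiplied by \<open>N\<close>, which is cancelled at the
        end.\<close>
      define N :: complex where "N = of_nat (Suc n)"
      have N: "N \<noteq> 0"
        unfolding N_def using of_nat_neq_0 by blast
      \<comment> \<open>Absorption turns the coefficients p + 1 and i + 1 of the Bernoulli
        recurrence into the two binomials of the induction hypotheses.\<close>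
      have binom1: "of_nat (Suc p) * of_nat (Suc n choose Suc p) = N * of_nat (n choose p)"
        unfolding N_def of_nat_mult[symmetric] by (simp only: Suc_times_binomial)
      have "Suc i * (Suc n choose Suc p) = Suc n * (n choose Suc p)"
        using binomial_absorb_comp[of "Suc n" "Suc p"] by (simp add: n)
      then have binom2: "of_nat (Suc i) * of_nat (Suc n choose Suc p) = N * of_nat (n choose Suc p)"
        unfolding N_def of_nat_mult[symmetric] by (simp only:)
      have "N - of_nat (Suc i) = of_nat (Suc p)"
        by (simp add: N_def n)
      then have r: "N * bernoulli_order (Suc (Suc n)) (Suc i)
          = of_nat (Suc p) * bernoulli_order (Suc n) (Suc i)
            - N * of_nat (Suc i) * bernoulli_order (Suc n) i"
        using rec[of i] unfolding N_def by simp
      have "N * (of_nat (Suc n choose Suc p) * bernoulli_order (Suc (Suc n)) (Suc i))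
          = of_nat (Suc n choose Suc p) * (N * bernoulli_order (Suc (Suc n)) (Suc i))"
        by (simp only: mult_ac)
      also have "\<dots> = (of_nat (Suc p) * of_nat (Suc n choose Suc p)) * bernoulli_order (Suc n) (Suc i)
          - N * (of_nat (Suc i) * of_nat (Suc n choose Suc p)) * bernoulli_order (Suc n) i"
        unfolding r by (simp only: right_diff_distrib mult_ac)
      also have "\<dots> = N * (of_nat (n choose p) * bernoulli_order (Suc n) (Suc i)
          - N * (of_nat (n choose Suc p) * bernoulli_order (Suc n) i))"
        unfolding binom1 binom2 by (simp only: right_diff_distrib mult_ac)
      also have "\<dots> = N * S1 (Suc (Suc n)) (Suc (Suc p))"
      proof -
        have "S1 (Suc n) (Suc p) = of_nat (n choose p) * bernoulli_order (Suc n) (Suc i)"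
          using Suc.IH[of p] by (simp add: n)
        moreover have "S1 (Suc n) (Suc (Suc p))
            = of_nat (n choose Suc p) * bernoulli_order (Suc n) i"
          using Suc.IH[of "Suc p"] by (simp add: n)
        ultimately show ?thesis
          by (simp only: S1_Suc_Suc[of "Suc n"] N_def)
      qed
      finally show ?thesis
        using N unfolding mult_cancel_left by (simp add: Suc n)
    qed
  qed
qed

corollary S1_eq_bernoulli_order':
  assumes "1 \<le> m" "m \<le> n"
  shows "S1 n m = of_nat ((n - 1) choose (m - 1)) * bernoulli_order n (n - m)"
  using S1_eq_bernoulli_order[of "m - 1" "n - 1"] assms by simp

section \<open>Products of Bernoulli numbers over n-tuples\<close>

lemma prod_list_divide_distrib:
  fixes f g :: "'a \<Rightarrow> 'b::field"
  shows "(\<Prod>x\<leftarrow>xs. f x / g x) = (\<Prod>x\<leftarrow>xs. f x) / (\<Prod>x\<leftarrow>xs. g x)"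
  by (induction xs) simp_all

lemma bernoulli_order_eq_sum_natpermute:
  assumes "n \<ge> 1"
  shows "bernoulli_order n l
    = fact l * (\<Sum>ls\<in>natpermute l n. (\<Prod>i\<leftarrow>ls. bernoulli_number i) / (\<Prod>i\<leftarrow>ls. fact i))"
proof -
  define g :: "complex fps" where "g = fps_X / (fps_exp 1 - 1)"
  have "(\<Prod>j\<in>{0..n - 1}. g $ (ls ! j)) = (\<Prod>i\<leftarrow>ls. bernoulli_number i) / (\<Prod>i\<leftarrow>ls. fact i)"
    if "ls \<in> natpermute l n" for ls
  proof -
    have "length ls = n"
      using that by (simp add: natpermute_def)
    \<comment> \<open>Since n >= 1, the range \<open>{0..n - 1}\<close> is exactly the set of
      positions of \<open>ls\<close>.\<close>
    then have "(\<Prod>j\<in>{0..n - 1}. g $ (ls ! j)) = (\<Prod>i\<leftarrow>ls. g $ i)"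
      using assms by (simp add: prod.list_conv_set_nth) (intro prod.cong, auto)
    also have "\<dots> = (\<Prod>i\<leftarrow>ls. bernoulli_number i / fact i)"
      by (simp add: bernoulli_number_def g_def)
    finally show ?thesis
      by (simp add: prod_list_divide_distrib)
  qed
  then show ?thesis
    using assms by (simp add: bernoulli_order_def fps_power_nth flip: g_def)
qed

text \<open>All tuples have the same sum l, so (n - 1)! / (n - 1 - l)! factors out and the rest is
  the Bernoulli number of order n and index l, divided by l!. The symmetry of the binomial then
  matches the explicit formula at m = n - l.\<close>

lemma sum_multinomial_bernoulli_number:
  assumes "l < n"
  shows "(\<Sum>ls\<in>natpermute l n. multinomial (n - 1) ls * (\<Prod>i\<leftarrow>ls. bernoulli_number i))
    = S1 n (n - l)"
proof -
  have "(\<Sum>ls\<in>natpermute l n. multinomial (n - 1) ls * (\<Prod>i\<leftarrow>ls. bernoulli_number i))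
      = (\<Sum>ls\<in>natpermute l n. fact (n - 1) / fact (n - 1 - l)
          * ((\<Prod>i\<leftarrow>ls. bernoulli_number i) / (\<Prod>i\<leftarrow>ls. fact i)))"
    by (rule sum.cong) (auto simp: natpermute_def multinomial_def)
  also have "\<dots> = fact (n - 1) / (fact l * fact (n - 1 - l)) * bernoulli_order n l"
    unfolding sum_distrib_left[symmetric]
    using assms by (simp add: bernoulli_order_eq_sum_natpermute)
  also have "fact (n - 1) / (fact l * fact (n - 1 - l)) = (of_nat ((n - 1) choose l) :: complex)"
    using assms by (intro binomial_fact[symmetric]) simp
  also have "(n - 1) choose l = (n - 1) choose (n - l - 1)"
    using assms binomial_symmetric[of l "n - 1"] by (simp add: diff_commute)
  also have "of_nat ((n - 1) choose (n - l - 1)) * bernoulli_order n l = S1 n (n - l)"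
    using assms S1_eq_bernoulli_order'[of "n - l" n] by simp
  finally show ?thesis .
qed

section \<open>Lah numbers and the substitution t / (1 - t)\<close>

lemma fps_X_over_one_minus_X_power_nth:
  fixes f :: "'a::comm_ring_1 fps"
  assumes "f = fps_X + fps_X * f"
  shows "f ^ Suc a $ Suc n = of_nat (n choose a)"
proof -
  have f0: "f $ 0 = 0"
    by (subst assms) simp
  \<comment> \<open>The hypothesis characterises f = t / (1 - t) without an inverse; multiplied by
    f^a it becomes Pascal's rule for the coefficients.\<close>
  have "f ^ Suc a = fps_X * f ^ a + fps_X * f ^ Suc a" for a
    by (subst power_Suc, subst assms) (simp add: algebra_simps)
  then have step: "f ^ Suc a $ Suc n = f ^ a $ n + f ^ Suc a $ n" for a n
    by (metis fps_add_nth fps_X_mult_nth diff_Suc_1 nat.distinct(1))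
  show ?thesis
  proof (induction n arbitrary: a)
    case 0
    show ?case
      by (simp only: step) (cases a; simp add: f0)
  next
    case (Suc n)
    show ?case
      by (cases a) (simp_all only: step[of _ "Suc n"] Suc.IH, simp_all)
  qed
qed

text \<open>The factors n! / a! * (n - 1 choose a - 1) are the unsigned Lah numbers. The coefficient
  at t^n of L^m composed with t / (1 - t) is computed twice: by expanding in powers of t / (1 - t),
  and from L(t / (1 - t)) = - L(-t).\<close>

lemma lah_transform_S1:
  assumes "n \<ge> 1"
  shows "(\<Sum>a=1..n. fact n / fact a * of_nat ((n - 1) choose (a - 1)) * S1 a m)
    = (-1) ^ (n + m) * S1 n m"
proof -
  define L :: "complex fps" where "L = fps_ln 1"
  define f :: "complex fps" where "f = fps_X * inverse (1 - fps_X)"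
  have inv: "(1 - fps_X) * inverse (1 - fps_X :: complex fps) = 1"
    by (rule inverse_mult_eq_1') simp
  have f: "f = fps_X + fps_X * f"
  proof -
    have "f - fps_X * f = fps_X * ((1 - fps_X) * inverse (1 - fps_X))"
      by (simp add: f_def algebra_simps)
    then show ?thesis
      by (simp only: inv) (simp add: algebra_simps)
  qed
  have f0: "f $ 0 = 0"
    by (simp add: f_def)
  have inv_f: "1 + f = inverse (1 - fps_X)"
    using inv by (simp add: f_def algebra_simps)
  \<comment> \<open>Both sides have derivative 1 / (1 - t) and constant term 0.\<close>
  have Lf: "L oo f = - (L oo - fps_X)"
  proof -
    have "fps_deriv (L oo f) = inverse (1 + f) * fps_deriv f"
      using f0 by (simp add: L_def fps_compose_deriv fps_ln_deriv fps_inverse_compose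
          fps_compose_add_distrib)
    also have "inverse (1 + f) = 1 - fps_X"
      by (simp add: inv_f)
    also have "fps_deriv f = fps_deriv (1 + f)"
      by simp
    also have "(1 - fps_X) * \<dots> = inverse (1 - fps_X)"
      unfolding inv_f
      by (simp add: fps_inverse_deriv power2_eq_square mult.assoc[symmetric] inv)
    also have "\<dots> = fps_deriv (- (L oo - fps_X))"
      by (simp add: L_def fps_compose_deriv fps_ln_deriv fps_inverse_compose
          fps_compose_add_distrib)
    finally show ?thesis
      unfolding fps_deriv_eq_iff by (simp add: L_def)
  qed
  have "(-1) ^ m = fps_const ((-1) ^ m :: complex)"
    by (simp flip: fps_const_neg fps_const_power)
  then have "(L ^ m oo f) = fps_const ((-1) ^ m) * (L ^ m oo - fps_X)"
    using f0 by (simp add: Lf power_minus[of "L oo - fps_X"] flip: fps_compose_power)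
  then have "(L ^ m oo f) $ n = (-1) ^ (n + m) * (L ^ m $ n)"
    by (simp add: fps_compose_uminus' power_add)
  moreover have "(L ^ m oo f) $ n = (\<Sum>a=1..n. (L ^ m $ a) * of_nat ((n - 1) choose (a - 1)))"
  proof -
    have "(L ^ m oo f) $ n = (\<Sum>a=0..n. (L ^ m $ a) * (f ^ a $ n))"
      by (rule fps_compose_nth)
    \<comment> \<open>The term a = 0 drops out because f^0 = 1 has coefficient 0 at t^n for n >=
      1.\<close>
    also have "\<dots> = (\<Sum>a=1..n. (L ^ m $ a) * (f ^ a $ n))"
      using assms by (simp add: sum.atLeast_Suc_atMost)
    also have "\<dots> = (\<Sum>a=1..n. (L ^ m $ a) * of_nat ((n - 1) choose (a - 1)))"
    proof (rule sum.cong)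
      fix a assume "a \<in> {1..n}"
      then show "(L ^ m $ a) * (f ^ a $ n) = (L ^ m $ a) * of_nat ((n - 1) choose (a - 1))"
        using fps_X_over_one_minus_X_power_nth[OF f, of "a - 1" "n - 1"] by simp
    qed simp
    finally show ?thesis .
  qed
  ultimately have "(\<Sum>a=1..n. (L ^ m $ a) * of_nat ((n - 1) choose (a - 1)))
      = (-1) ^ (n + m) * (L ^ m $ n)"
    by simp
  then have "fact n / fact m * (\<Sum>a=1..n. (L ^ m $ a) * of_nat ((n - 1) choose (a - 1)))
      = (-1) ^ (n + m) * S1 n m"
    by (simp add: S1_def L_def)
  then show ?thesis
    by (simp add: S1_def L_def sum_distrib_left mult_ac)
qed

section \<open>Stirling sums with arbitrary weights\<close>

lemma weighted_sum_S1_eq_multinomial: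
  fixes w :: "nat \<Rightarrow> complex"
  assumes "1 \<le> j" "j \<le> n"
  shows "(\<Sum>m=j..n. w m * S1 n m)
    = (\<Sum>l=0..n - j. \<Sum>ls\<in>natpermute l n.
        multinomial (n - 1) ls * (\<Prod>i\<leftarrow>ls. bernoulli_number i) * w (n - l))"
proof -
  have "(\<Sum>m=j..n. w m * S1 n m) = (\<Sum>l=0..n - j. w (n - l) * S1 n (n - l))"
    using assms
    by (intro sum.reindex_bij_witness[of _ "\<lambda>l. n - l" "\<lambda>m. n - m"]) auto
  also have "\<dots> = (\<Sum>l=0..n - j. \<Sum>ls\<in>natpermute l n.
        multinomial (n - 1) ls * (\<Prod>i\<leftarrow>ls. bernoulli_number i) * w (n - l))"
    using assms
    by (intro sum.cong refl, subst sum_distrib_right[symmetric],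
        subst sum_multinomial_bernoulli_number) auto
  finally show ?thesis .
qed

text \<open>Solve the Lah transform for S1 n m, exchange the sums over a and m, and insert the
  explicit formula for S1 a m with m = l + 1.\<close>

lemma weighted_sum_S1_eq_bernoulli_order:
  fixes w :: "nat \<Rightarrow> complex"
  assumes "1 \<le> j" "j \<le> n"
  shows "(\<Sum>m=j..n. w m * S1 n m)
    = (-1) ^ n * fact n *
      (\<Sum>a=j..n. \<Sum>l=j - 1..a - 1.
         (-1) ^ (l + 1) / fact a * of_nat ((n - 1) choose (a - 1))
           * of_nat ((a - 1) choose l) * bernoulli_order a (a - 1 - l) * w (l + 1))"
proof -
  define c :: "nat \<Rightarrow> nat \<Rightarrow> complex" where
    "c a m = (-1) ^ m / fact a * of_nat ((n - 1) choose (a - 1)) * S1 a m * w m" for a m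
  have inner: "(\<Sum>l=j - 1..a - 1.
         (-1) ^ (l + 1) / fact a * of_nat ((n - 1) choose (a - 1))
           * of_nat ((a - 1) choose l) * bernoulli_order a (a - 1 - l) * w (l + 1))
      = (\<Sum>m=j..n. c a m)" if "a \<in> {j..n}" for a
  proof -
    have "(\<Sum>l=j - 1..a - 1.
         (-1) ^ (l + 1) / fact a * of_nat ((n - 1) choose (a - 1))
           * of_nat ((a - 1) choose l) * bernoulli_order a (a - 1 - l) * w (l + 1))
        = (\<Sum>m=j..a. c a m)"
      using assms that
      by (intro sum.reindex_bij_witness[of _ "\<lambda>m. m - 1" "\<lambda>l. l + 1"])
         (auto simp: c_def S1_eq_bernoulli_order')
    \<comment> \<open>The added terms m > a vanish; the range of m no longer depends on a, so the
      sums can be swapped.\<close>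
    also have "\<dots> = (\<Sum>m=j..n. c a m)"
      using that by (intro sum.mono_neutral_left) (auto simp: c_def S1_eq_0)
    finally show ?thesis .
  qed
  have outer: "(-1) ^ n * fact n * (\<Sum>a=j..n. c a m) = w m * S1 n m" if "m \<in> {j..n}" for m
  proof -
    \<comment> \<open>The added terms have a < j <= m and vanish, which gives the full range of the
      Lah transform.\<close>
    have "(\<Sum>a=j..n. c a m) = (\<Sum>a=1..n. c a m)"
      using assms that by (intro sum.mono_neutral_left) (auto simp: c_def S1_eq_0)
    then have "(-1) ^ n * fact n * (\<Sum>a=j..n. c a m) = (-1) ^ (n + m) * w m *
        (\<Sum>a=1..n. fact n / fact a * of_nat ((n - 1) choose (a - 1)) * S1 a m)"
      by (simp add: c_def sum_distrib_left power_add mult_ac)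
    also have "\<dots> = ((-1) ^ (n + m) * (-1) ^ (n + m)) * (w m * S1 n m)"
      using assms by (subst lah_transform_S1) (simp_all add: mult_ac)
    also have "(-1) ^ (n + m) * (-1) ^ (n + m) = (1 :: complex)"
      by (simp flip: power_mult_distrib)
    finally show ?thesis
      by simp
  qed
  have "(\<Sum>m=j..n. w m * S1 n m) = (\<Sum>m=j..n. (-1) ^ n * fact n * (\<Sum>a=j..n. c a m))"
    using outer by (intro sum.cong) simp_all
  also have "\<dots> = (-1) ^ n * fact n * (\<Sum>a=j..n. \<Sum>m=j..n. c a m)"
    by (subst sum.swap) (simp add: sum_distrib_left)
  finally show ?thesis
    using inner by simp
qed

section \<open>Poly-Cauchy numbers and the final identities\<close>

lemma poly_cauchy_number_eq_sum_S1:
  "poly_cauchy_number k n = (\<Sum>m=0..n. S1 n m / of_nat (m + 1) powi k)"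
  \<comment> \<open>At x = 0 the divisor (1 + t)^x is 1, and the m! in \<open>Lif\<close> is the one
    in \<open>S1\<close>.\<close>
  by (simp add: poly_cauchy_number_def poly_cauchy_def Lif_def S1_def fps_compose_nth
      sum_distrib_left mult_ac)

theorem theorem2:
  fixes k :: int and n :: nat
  assumes "n \<ge> 1"
  shows
    "(\<forall>j::nat. 1 \<le> j \<and> j \<le> n \<longrightarrow>
        (\<Sum>m=j..n. of_nat (m choose j) / of_nat (m - j + 1) powi k * S1 n m)
          = (\<Sum>l=0..n - j. \<Sum>ls\<in>natpermute l n.
               multinomial (n - 1) ls * of_nat ((n - l) choose j)
                 * ((\<Prod>i\<leftarrow>ls. bernoulli_number i) / of_nat (n - l - j + 1) powi k))
      \<and> (\<Sum>l=0..n - j. \<Sum>ls\<in>natpermute l n.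
               multinomial (n - 1) ls * of_nat ((n - l) choose j)
                 * ((\<Prod>i\<leftarrow>ls. bernoulli_number i) / of_nat (n - l - j + 1) powi k))
          = (-1) ^ (n + j) * fact n *
            (\<Sum>a=j..n. \<Sum>l=j - 1..a - 1.
               (-1) ^ (l + 1 - j) / fact a * of_nat ((n - 1) choose (a - 1))
                 * of_nat ((a - 1) choose l) * of_nat ((l + 1) choose j)
                 * (bernoulli_order a (a - 1 - l) / of_nat (l + 2 - j) powi k)))
     \<and> poly_cauchy_number k n = (\<Sum>m=0..n. S1 n m / of_nat (m + 1) powi k)
     \<and> (\<Sum>m=0..n. S1 n m / of_nat (m + 1) powi k)
          = (\<Sum>l=0..n - 1. \<Sum>ls\<in>natpermute l n.
               multinomial (n - 1) ls
                 * ((\<Prod>i\<leftarrow>ls. bernoulli_number i) / of_nat (n - l + 1) powi k))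
     \<and> (\<Sum>l=0..n - 1. \<Sum>ls\<in>natpermute l n.
               multinomial (n - 1) ls
                 * ((\<Prod>i\<leftarrow>ls. bernoulli_number i) / of_nat (n - l + 1) powi k))
          = (-1) ^ n * fact n *
            (\<Sum>a=1..n. \<Sum>l=0..a - 1.
               (-1) ^ (l + 1) / fact a * of_nat ((n - 1) choose (a - 1))
                 * of_nat ((a - 1) choose l)
                 * (bernoulli_order a (a - 1 - l) / of_nat (l + 2) powi k))"
proof (intro conjI allI impI)
  fix j :: nat
  assume j: "1 \<le> j \<and> j \<le> n"
  define w :: "nat \<Rightarrow> complex" where
    "w m = of_nat (m choose j) / of_nat (m - j + 1) powi k" for m
  let ?mid = "\<Sum>l=0..n - j. \<Sum>ls\<in>natpermute l n.
      multinomial (n - 1) ls * of_nat ((n - l) choose j)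
        * ((\<Prod>i\<leftarrow>ls. bernoulli_number i) / of_nat (n - l - j + 1) powi k)"
  have mid: "(\<Sum>m=j..n. w m * S1 n m) = ?mid"
    using j by (subst weighted_sum_S1_eq_multinomial) (simp_all add: w_def mult_ac)
  then show "(\<Sum>m=j..n. of_nat (m choose j) / of_nat (m - j + 1) powi k * S1 n m) = ?mid"
    by (simp only: w_def)
  define t :: "nat \<Rightarrow> nat \<Rightarrow> complex" where
    "t a l = (-1) ^ (l + 1 - j) / fact a * of_nat ((n - 1) choose (a - 1))
       * of_nat ((a - 1) choose l) * of_nat ((l + 1) choose j)
       * (bernoulli_order a (a - 1 - l) / of_nat (l + 2 - j) powi k)" for a l
  \<comment> \<open>For l >= j - 1 the subtractions l + 1 - j and l + 2 - j are not truncated;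
    (-1)^j splits off and later joins (-1)^n.\<close>
  have summand: "(-1) ^ (l + 1) / fact a * of_nat ((n - 1) choose (a - 1))
      * of_nat ((a - 1) choose l) * bernoulli_order a (a - 1 - l) * w (l + 1) = (-1) ^ j * t a l"
    if "l \<in> {j - 1..a - 1}" for a l
  proof -
    have "l + 1 = j + (l + 1 - j)"
      using that by auto
    then have "(-1 :: complex) ^ (l + 1) = (-1) ^ j * (-1) ^ (l + 1 - j)"
      by (metis power_add)
    moreover have "l + 1 - j + 1 = l + 2 - j"
      using that by auto
    ultimately show ?thesis
      by (simp only: w_def t_def) simp
  qed
  have "?mid = (-1) ^ n * fact n * (\<Sum>a=j..n. \<Sum>l=j - 1..a - 1. (-1) ^ j * t a l)"
    unfolding mid[symmetric]
    using j by (subst weighted_sum_S1_eq_bernoulli_order) (simp_all only: summand cong: sum.cong)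
  also have "\<dots> = (-1) ^ (n + j) * fact n * (\<Sum>a=j..n. \<Sum>l=j - 1..a - 1. t a l)"
    by (simp only: sum_distrib_left[symmetric]) (simp only: power_add mult_ac)
  finally show "?mid = (-1) ^ (n + j) * fact n *
      (\<Sum>a=j..n. \<Sum>l=j - 1..a - 1.
         (-1) ^ (l + 1 - j) / fact a * of_nat ((n - 1) choose (a - 1))
           * of_nat ((a - 1) choose l) * of_nat ((l + 1) choose j)
           * (bernoulli_order a (a - 1 - l) / of_nat (l + 2 - j) powi k))"
    by (simp only: t_def)
next
  show "poly_cauchy_number k n = (\<Sum>m=0..n. S1 n m / of_nat (m + 1) powi k)"
    by (rule poly_cauchy_number_eq_sum_S1)
next
  define w :: "nat \<Rightarrow> complex" where "w m = 1 / of_nat (m + 1) powi k" for m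
  let ?mid = "\<Sum>l=0..n - 1. \<Sum>ls\<in>natpermute l n. multinomial (n - 1) ls
      * ((\<Prod>i\<leftarrow>ls. bernoulli_number i) / of_nat (n - l + 1) powi k)"
  have mid: "(\<Sum>m=1..n. w m * S1 n m) = ?mid"
    using assms by (subst weighted_sum_S1_eq_multinomial) (simp_all add: w_def mult_ac)
  \<comment> \<open>Since n >= 1 the term m = 0 vanishes, which reduces the sum to the weighted
    identities at j = 1.\<close>
  have "S1 n 0 = 0"
    using assms S1_0_right[of "n - 1"] by simp
  then have "(\<Sum>m=0..n. S1 n m / of_nat (m + 1) powi k) = (\<Sum>m=1..n. w m * S1 n m)"
    using assms by (simp add: sum.atLeast_Suc_atMost w_def)
  then show "(\<Sum>m=0..n. S1 n m / of_nat (m + 1) powi k) = ?mid"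
    unfolding mid .
  show "?mid = (-1) ^ n * fact n *
      (\<Sum>a=1..n. \<Sum>l=0..a - 1.
         (-1) ^ (l + 1) / fact a * of_nat ((n - 1) choose (a - 1))
           * of_nat ((a - 1) choose l)
           * (bernoulli_order a (a - 1 - l) / of_nat (l + 2) powi k))"
    unfolding mid[symmetric]
    using assms by (subst weighted_sum_S1_eq_bernoulli_order) (simp_all add: w_def)
qed

end
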